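(* Let $X,Y$ be separable Hilbert spaces, let $(X_N)_{N\in\mathbb{N}_0}$ be a nested family of subspaces of $X$ with orthogonal projectors $P_N:X\to X_N$, and let $T_N:X_N\to Y$ be linear operators with (i) $\|T_N\|\le 1$, (ii) $T_Nx_M=T_Mx_M$ for all $N\ge M$ and $x_M\in X_M$, (iii) $\mathcal{R}(T_N^* )\subseteq X_N$. Let $y\in Y$ and assume that there exist $N_*\in\mathbb{N}_0$ and $x_*\in X_{N_*}$ with $T_{N_*}x_*=y$. Then, for exact data ($\delta=0$, $y^\delta=y$), the multi-level CGNE algorithm converges to a solution $\hat x$; that is, either the algorithm terminates after finitely many iterations and its output $\hat x$ is a solution, or it does not terminate and the iterates it generates converge in norm to a solution $\hat x$.
   Context: Nested means $X_N\subseteq X_{N+1}$ for all $N$. A solution is an element $x\in X_N$, for some $N\in\mathbb{N}_0$, with $T_Nx=y$ (by (ii), a solution on a lower level is a solution on every higher level). CGNE at level $N$ for data $y^\delta$ with starting element $x_0\in X_N$ (write $T=T_N$): set $r_0=w_0=y^\delta-Tx_0$ and, for $k=0,1,2,\dots$, $d_k=T^*w_k$, $\alpha_k=\|T^*r_k\|^2/\|Td_k\|^2$, $x_{k+1}=x_k+\alpha_kd_k$, $r_{k+1}=r_k-\alpha_kTd_k$, $\beta_k=\|T^*r_{k+1}\|^2/\|T^*r_k\|^2$, $w_{k+1}=r_{k+1}+\beta_kw_k$. The iterates at level $N$ are denoted $x_{k,N}^\delta$. Multi-level CGNE algorithm (parameters $\eta>0$, $\tau>1$, noise level $\delta\ge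 0$, data $y^\delta$ with $\|y^\delta-y\|\le\delta$). Level $0$: given $x_{0,0}^\delta\in X_0$, consider the conditions (a) $\|T_0x_{0,0}^\delta-y^\delta\|^2>2(1+\eta)(\delta+\|P_0x_*-x_*\|)\|y^\delta\|$ and (b) $\|T_0x_{0,0}^\delta-y^\delta\|^2>2(1+\eta)\tau\delta\|y^\delta\|$. If (b) fails, $x_{0,0}^\delta$ is accepted as approximate solution and the algorithm terminates. If (b) holds and (a) fails, one chooses a level $J$ with $\|T_Jx_{0,0}^\delta-y^\delta\|^2>2(1+\eta)(\delta+\|P_Jx_*-x_*\|)\|y^\delta\|$ and renumbers the levels so that $J$ becomes level $0$. Then CGNE is run at level $0$ from $x_{0,0}^\delta$ until, for the first time, $\|T_0x_{k+1,0}^\delta-y^\delta\|^2\le 2(1+\eta)(\delta+\|P_0x_*-x_*\|)\|y^\delta\|$; this $k$ is denoted $k_*(0,\delta)$. From level $N$ to level $N+1$: if $\|T_{N+1}x_{k_*(N,\delta)+1,N}^\delta-y^\delta\|^2\le 2(1+\eta)\tau\delta\|y^\delta\|$, the algorithm terminates with output $x_{k_*(N,\delta)+1,N}^\delta$. Otherwise set $x_{0,N+1}^\delta:=x_{k_*(N,\delta),N}^\delta$ and run CGNE at level $N+1$ from $x_{0,N+1}^\delta$ until, for the first time, $\|T_{N+1}x_{k+1,N+1}^\delta-y^\delta\|^2\le 2(1+\eta)(\delta+\|P_{N+1}x_*-x_*\|)\|y^\delta\|$; this $k$ is denoted $k_*(N+1,\delta)$. *)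

theory Defs
  imports "HOL-Analysis.Analysis"
begin

definition linear_on_subspace ::
  "'x::real_vector set \<Rightarrow> ('x \<Rightarrow> 'y::real_vector) \<Rightarrow> bool" where
  "linear_on_subspace S A \<longleftrightarrow>
     (\<forall>u\<in>S. \<forall>v\<in>S. A (u + v) = A u + A v) \<and> (\<forall>c. \<forall>u\<in>S. A (c *\<^sub>R u) = c *\<^sub>R A u)"

(* The existence of an orthogonal projector onto S forces S to be closed. *)
definition orthogonal_projector ::
  "'x::real_inner set \<Rightarrow> ('x \<Rightarrow> 'x) \<Rightarrow> bool" where
  "orthogonal_projector S Q \<longleftrightarrow> (\<forall>x. Q x \<in> S \<and> (\<forall>u\<in>S. orthogonal (x - Q x) u))"

(* Adjoint relation for an operator defined on S only (values of A outside S are irrelevant).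
   Together with range A' \<subseteq> S it determines A' uniquely; for S closed and A linear and bounded
   on S, such an A' exists by the Riesz theorem. *)
definition adjoint_on ::
  "'x::real_inner set \<Rightarrow> ('x \<Rightarrow> 'y::real_inner) \<Rightarrow> ('y \<Rightarrow> 'x) \<Rightarrow> bool" where
  "adjoint_on S A A' \<longleftrightarrow> (\<forall>x\<in>S. \<forall>v. A x \<bullet> v = x \<bullet> A' v)"

definition is_solution ::
  "(nat \<Rightarrow> 'x set) \<Rightarrow> (nat \<Rightarrow> 'x \<Rightarrow> 'y) \<Rightarrow> 'y \<Rightarrow> 'x \<Rightarrow> bool" where
  "is_solution X T y x \<longleftrightarrow> (\<exists>N. x \<in> X N \<and> T N x = y)"

(* CGNE for data b, started at x0; the k-th state is (x_k, r_k, w_k).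
   For an adjoint pair, a denominator first vanishes only if A' r_k = 0 (as
   A d_k \<bullet> r_k = (norm (A' r_k))^2); HOL's a / 0 = 0 then keeps x_k unchanged from then on. *)
primrec cgne ::
  "('x::real_inner \<Rightarrow> 'y::real_inner) \<Rightarrow> ('y \<Rightarrow> 'x) \<Rightarrow> 'y \<Rightarrow> 'x \<Rightarrow> nat \<Rightarrow> 'x \<times> 'y \<times> 'y" where
  "cgne A A' b x0 0 = (x0, b - A x0, b - A x0)"
| "cgne A A' b x0 (Suc k) =
     (let (x, r, w) = cgne A A' b x0 k;
          d = A' w;
          \<alpha> = (norm (A' r))\<^sup>2 / (norm (A d))\<^sup>2;
          r' = r - \<alpha> *\<^sub>R A d;
          \<beta> = (norm (A' r'))\<^sup>2 / (norm (A' r))\<^sup>2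
      in (x + \<alpha> *\<^sub>R d, r', r' + \<beta> *\<^sub>R w))"

definition cgne_iterate ::
  "('x::real_inner \<Rightarrow> 'y::real_inner) \<Rightarrow> ('y \<Rightarrow> 'x) \<Rightarrow> 'y \<Rightarrow> 'x \<Rightarrow> nat \<Rightarrow> 'x" where
  "cgne_iterate A A' b x0 k = fst (cgne A A' b x0 k)"

definition level_bound ::
  "(nat \<Rightarrow> 'x \<Rightarrow> 'x::real_inner) \<Rightarrow> 'x \<Rightarrow> real \<Rightarrow> real \<Rightarrow> 'y::real_inner \<Rightarrow> nat \<Rightarrow> real" where
  "level_bound P xs \<eta> \<delta> b N = 2 * (1 + \<eta>) * (\<delta> + norm (P N xs - xs)) * norm b"

definition final_bound :: "real \<Rightarrow> real \<Rightarrow> real \<Rightarrow> 'y::real_inner \<Rightarrow> real" where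
  "final_bound \<eta> \<tau> \<delta> b = 2 * (1 + \<eta>) * \<tau> * \<delta> * norm b"

(* Iterating N z k: CGNE is being run at level N from the starting element z, and its k-th
   iterate (at level N) has just been computed.  Finished x: terminated with output x. *)
datatype 'x ml_state = Iterating nat 'x nat | Finished 'x

(* Possible states after the initialisation at level 0.  The choice of the level J is left
   open.  Instead of renumbering the levels, the run starts at level J. *)
definition ml_initial ::
  "(nat \<Rightarrow> 'x \<Rightarrow> 'y::real_inner) \<Rightarrow> (nat \<Rightarrow> 'x \<Rightarrow> 'x::real_inner) \<Rightarrow> 'x \<Rightarrow>
   real \<Rightarrow> real \<Rightarrow> real \<Rightarrow> 'y \<Rightarrow> 'x \<Rightarrow> 'x ml_state \<Rightarrow> bool" where
  "ml_initial T P xs \<eta> \<tau> \<delta> b x00 s \<longleftrightarrow>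
     (if \<not> (norm (T 0 x00 - b))\<^sup>2 > final_bound \<eta> \<tau> \<delta> b then s = Finished x00
      else if (norm (T 0 x00 - b))\<^sup>2 > level_bound P xs \<eta> \<delta> b 0 then s = Iterating 0 x00 0
      else \<exists>J. (norm (T J x00 - b))\<^sup>2 > level_bound P xs \<eta> \<delta> b J \<and> s = Iterating J x00 0)"

(* The discrepancy test at a level is applied to the iterates with index k > 0 only; the first
   such k passing it is k_*(N) + 1, so that the next level starts from the iterate k - 1. *)
primrec ml_step ::
  "(nat \<Rightarrow> 'x \<Rightarrow> 'y::real_inner) \<Rightarrow> (nat \<Rightarrow> 'y \<Rightarrow> 'x) \<Rightarrow> (nat \<Rightarrow> 'x \<Rightarrow> 'x::real_inner) \<Rightarrow> 'x \<Rightarrow>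
   real \<Rightarrow> real \<Rightarrow> real \<Rightarrow> 'y \<Rightarrow> 'x ml_state \<Rightarrow> 'x ml_state" where
  "ml_step T T' P xs \<eta> \<tau> \<delta> b (Iterating N z k) =
     (let x = cgne_iterate (T N) (T' N) b z k in
      if k > 0 \<and> (norm (T N x - b))\<^sup>2 \<le> level_bound P xs \<eta> \<delta> b N then
        (if (norm (T (Suc N) x - b))\<^sup>2 \<le> final_bound \<eta> \<tau> \<delta> b then Finished x
         else Iterating (Suc N) (cgne_iterate (T N) (T' N) b z (k - 1)) 0)
      else Iterating N z (Suc k))"
| "ml_step T T' P xs \<eta> \<tau> \<delta> b (Finished x) = Finished x"

definition ml_run ::
  "(nat \<Rightarrow> 'x \<Rightarrow> 'y::real_inner) \<Rightarrow> (nat \<Rightarrow> 'y \<Rightarrow> 'x) \<Rightarrow> (nat \<Rightarrow> 'x \<Rightarrow> 'x::real_inner) \<Rightarrow> 'x \<Rightarrow>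
   real \<Rightarrow> real \<Rightarrow> real \<Rightarrow> 'y \<Rightarrow> 'x ml_state \<Rightarrow> nat \<Rightarrow> 'x ml_state" where
  "ml_run T T' P xs \<eta> \<tau> \<delta> b s n = (ml_step T T' P xs \<eta> \<tau> \<delta> b ^^ n) s"

primrec ml_iterate ::
  "(nat \<Rightarrow> 'x \<Rightarrow> 'y::real_inner) \<Rightarrow> (nat \<Rightarrow> 'y \<Rightarrow> 'x::real_inner) \<Rightarrow> 'y \<Rightarrow> 'x ml_state \<Rightarrow> 'x" where
  "ml_iterate T T' b (Iterating N z k) = cgne_iterate (T N) (T' N) b z k"
| "ml_iterate T T' b (Finished x) = x"

end

(* At a level N with xs not in X N and y nonzero, the CGNE residuals converge to a limit whose
   norm is at most norm (y - T N u) for every u in X N.  Taking u = 0 and u = P N xs bounds its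
   square by norm (P N xs - xs) * norm y, strictly below the discrepancy bound, so such a level
   is left after finitely many steps.  From level Ns on the discrepancy bound is 0, hence only
   finitely many levels are visited.  At a level with discrepancy bound 0 the equation is
   solvable, and the algorithm either stops at a solution or runs CGNE forever.  In the latter
   case the Hestenes-Stiefel relations w_i \<bullet> r_k \<ge> 0 for i \<le> k make the errors e_k
   satisfy dist (e_j, e_k)^2 \<le> (norm e_j)^2 - (norm e_k)^2 for j \<le> k, so the iterates are a
   Cauchy sequence, and A' r_k \<longrightarrow> 0 identifies the limit as a solution. *)
theory Submission
  imports Defs
begin

section \<open>Conjugate gradients for the normal equation\<close>

text \<open>\<open>g\<close> is nonincreasing and bounded below, hence convergent, so its
  differences control the distances. It is applied with squared residual norms and with squared
  errors as \<open>g\<close>.\<close>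

lemma Cauchy_dist_le_telescope:
  fixes f :: "nat \<Rightarrow> 'a::metric_space" and g :: "nat \<Rightarrow> real"
  assumes le: "\<And>j k. j \<le> k \<Longrightarrow> (dist (f j) (f k))\<^sup>2 \<le> g j - g k"
    and nonneg: "\<And>k. 0 \<le> g k"
  shows "Cauchy f"
proof (rule metric_CauchyI)
  fix e :: real assume e: "0 < e"
  have "decseq g"
    unfolding decseq_def using le by (smt (verit) zero_le_power2)
  then have "Cauchy g"
    using decseq_convergent[of g 0] nonneg LIMSEQ_imp_Cauchy by metis
  then obtain M where M: "\<And>m n. M \<le> m \<Longrightarrow> M \<le> n \<Longrightarrow> dist (g m) (g n) < e\<^sup>2"
    using e by (meson metric_CauchyD zero_less_power)
  have *: "dist (f m) (f n) < e" if "M \<le> m" "m \<le> n" for m n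
  proof -
    have "(dist (f m) (f n))\<^sup>2 < e\<^sup>2"
      using le[OF that(2)] M[of m n] that by (simp add: dist_real_def)
    then show ?thesis
      using e by (simp add: power2_less_imp_less)
  qed
  have "dist (f m) (f n) < e" if "M \<le> m" "M \<le> n" for m n
    using *[of m n] *[of n m] that by (cases "m \<le> n") (auto simp: dist_commute)
  then show "\<exists>M. \<forall>m\<ge>M. \<forall>n\<ge>M. dist (f m) (f n) < e"
    by blast
qed

text \<open>\<open>b\<close> is left arbitrary because the equation at a level below
  \<open>Ns\<close> may be unsolvable; a solution is assumed only where errors are studied.\<close>

locale cgne_problem =
  fixes S :: "'x::real_inner set" and A :: "'x \<Rightarrow> 'y::real_inner" and A' :: "'y \<Rightarrow> 'x"
    and b :: 'y and x0 :: 'x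
  assumes subspace: "subspace S"
    and linear: "linear_on_subspace S A"
    and norm_A: "\<And>u. u \<in> S \<Longrightarrow> norm (A u) \<le> norm u"
    and adjoint: "adjoint_on S A A'"
    and range_A': "range A' \<subseteq> S"
    and x0: "x0 \<in> S"
begin

definition iter :: "nat \<Rightarrow> 'x" where
  "iter k = cgne_iterate A A' b x0 k"

definition res :: "nat \<Rightarrow> 'y" where
  "res k = fst (snd (cgne A A' b x0 k))"

definition aux :: "nat \<Rightarrow> 'y" where
  "aux k = snd (snd (cgne A A' b x0 k))"

definition dir :: "nat \<Rightarrow> 'x" where
  "dir k = A' (aux k)"

text \<open>The negative gradient on \<open>S\<close> of half the squared residual norm, taken at
  \<open>iter k\<close>.\<close>

definition grad :: "nat \<Rightarrow> 'x" where
  "grad k = A' (res k)"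

definition step :: "nat \<Rightarrow> real" where
  "step k = (norm (grad k))\<^sup>2 / (norm (A (dir k)))\<^sup>2"

definition corr :: "nat \<Rightarrow> real" where
  "corr k = (norm (grad (Suc k)))\<^sup>2 / (norm (grad k))\<^sup>2"

lemma iter_0: "iter 0 = x0"
  and res_0: "res 0 = b - A x0"
  and aux_0: "aux 0 = res 0"
  by (simp_all add: iter_def res_def aux_def cgne_iterate_def)

lemma iter_Suc: "iter (Suc k) = iter k + step k *\<^sub>R dir k"
  and res_Suc: "res (Suc k) = res k - step k *\<^sub>R A (dir k)"
  by (simp_all add: iter_def res_def aux_def cgne_iterate_def dir_def grad_def step_def
      Let_def case_prod_beta)

lemma aux_Suc: "aux (Suc k) = res (Suc k) + corr k *\<^sub>R aux k"
  by (simp add: res_def aux_def dir_def grad_def corr_def Let_def case_prod_beta)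

section \<open>Linearity of the operator and of its adjoint\<close>

lemma A_add: "u \<in> S \<Longrightarrow> v \<in> S \<Longrightarrow> A (u + v) = A u + A v"
  and A_scale: "u \<in> S \<Longrightarrow> A (c *\<^sub>R u) = c *\<^sub>R A u"
  using linear by (auto simp: linear_on_subspace_def)

lemma A_zero: "A 0 = 0"
  using A_scale[of 0 0] subspace by (simp add: subspace_0)

lemma A_diff:
  assumes "u \<in> S" "v \<in> S" shows "A (u - v) = A u - A v"
  using A_add[of u "(-1) *\<^sub>R v"] A_scale[of v "-1"] assms subspace_scale[OF subspace, of v "-1"]
  by simp

lemma adj: "u \<in> S \<Longrightarrow> A u \<bullet> v = u \<bullet> A' v"
  using adjoint by (simp add: adjoint_on_def)

lemma A'_in: "A' v \<in> S"
  using range_A' by auto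

text \<open>Both candidates lie in \<open>S\<close>, so testing against their difference identifies
  them. Linearity of \<open>A'\<close> is derived from this uniqueness.\<close>

lemma A'_eqI:
  assumes "s \<in> S" and "\<And>u. u \<in> S \<Longrightarrow> A u \<bullet> v = u \<bullet> s"
  shows "A' v = s"
proof -
  have "A' v - s \<in> S"
    using A'_in assms(1) subspace by (simp add: subspace_diff)
  then have "(A' v - s) \<bullet> (A' v - s) = 0"
    using adj[of "A' v - s" v] assms(2)[of "A' v - s"] by (simp add: inner_diff_right)
  then show ?thesis by simp
qed

lemma A'_add: "A' (u + v) = A' u + A' v"
  by (rule A'_eqI) (simp_all add: A'_in subspace subspace_add inner_add_right adj)

lemma A'_scale: "A' (c *\<^sub>R v) = c *\<^sub>R A' v"
  by (rule A'_eqI) (simp_all add: A'_in subspace subspace_scale adj)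

lemma A'_diff: "A' (u - v) = A' u - A' v"
  by (rule A'_eqI) (simp_all add: A'_in subspace subspace_diff inner_diff_right adj)

lemma dir_in: "dir k \<in> S" and grad_in: "grad k \<in> S"
  by (simp_all add: dir_def grad_def A'_in)

lemma iter_in: "iter k \<in> S"
  by (induction k) (simp_all add: iter_0 iter_Suc x0 dir_in subspace subspace_add subspace_scale)

lemma res_eq: "res k = b - A (iter k)"
  by (induction k)
    (simp_all add: iter_0 res_0 iter_Suc res_Suc A_add A_scale iter_in dir_in subspace
      subspace_scale)

lemma dir_0: "dir 0 = grad 0"
  by (simp add: dir_def grad_def aux_0)

lemma dir_Suc: "dir (Suc k) = grad (Suc k) + corr k *\<^sub>R dir k"
  by (simp add: dir_def grad_def aux_Suc A'_add A'_scale)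

lemma grad_Suc: "grad (Suc k) = grad k - step k *\<^sub>R A' (A (dir k))"
  by (simp add: grad_def res_Suc A'_diff A'_scale)

section \<open>Breakdown, conjugate directions and orthogonality\<close>

lemma A_dir_inner: "A (dir j) \<bullet> res k = dir j \<bullet> grad k"
  by (simp add: adj dir_in grad_def)

text \<open>A vanishing gradient makes \<open>step\<close> zero, so the residual is frozen from then
  on.\<close>

lemma grad_eq_0_mono:
  assumes "grad j = 0" "j \<le> k" shows "grad k = 0"
  using assms(2)
proof (induction rule: dec_induct)
  case base
  show ?case by (fact assms(1))
next
  case (step k)
  then show ?case
    by (simp add: grad_Suc step_def)
qed

lemma corr_mult: "corr k * (norm (grad k))\<^sup>2 = (norm (grad (Suc k)))\<^sup>2"
  using grad_eq_0_mono[of k "Suc k"] by (auto simp: corr_def)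

lemma dir_eq_0: "grad k = 0 \<Longrightarrow> dir k = 0"
  by (cases k) (simp_all add: dir_0 dir_Suc corr_def)

text \<open>\<open>step\<close> makes the new residual orthogonal to the current image direction and
  keeps the earlier orthogonalities, so the gradients become mutually orthogonal. As
  \<open>A' (A (dir j))\<close>, scaled by \<open>step j\<close>, is a difference of successive
  gradients, only \<open>j = k\<close> obstructs conjugacy, and \<open>corr\<close> cancels that
  term.\<close>

lemma orthogonality:
  "\<forall>j<k. A (dir j) \<bullet> res k = 0 \<and> A (dir j) \<bullet> A (dir k) = 0"
  and descent: "A (dir k) \<bullet> res k = (norm (grad k))\<^sup>2"
proof -
  \<comment> \<open>Conditional on orthogonality, so that it serves both inside the induction and
    after it.\<close>
  have descent': "A (dir k) \<bullet> res k = (norm (grad k))\<^sup>2"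
    if "\<forall>j<k. A (dir j) \<bullet> res k = 0" for k
  proof (cases k)
    case 0
    then show ?thesis
      unfolding 0 A_dir_inner by (simp add: dir_0 power2_norm_eq_inner)
  next
    case (Suc i)
    then show ?thesis
      using that unfolding A_dir_inner by (simp add: A_dir_inner dir_Suc power2_norm_eq_inner inner_add_left)
  qed
  have *: "\<forall>j<k. A (dir j) \<bullet> res k = 0 \<and> A (dir j) \<bullet> A (dir k) = 0" for k
  proof (induction k)
    case 0
    show ?case by simp
  next
    case (Suc k)
    have dsc: "A (dir k) \<bullet> res k = (norm (grad k))\<^sup>2"
      using Suc by (intro descent') simp
    \<comment> \<open>Division-free form of \<open>step\<close>: if \<open>A (dir k) = 0\<close>,
      then \<open>dsc\<close> forces \<open>grad k = 0\<close> and both sides vanish.\<close>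
    have stp: "step k * (A (dir k) \<bullet> A (dir k)) = (norm (grad k))\<^sup>2"
      using dsc by (cases "A (dir k) = 0") (simp_all add: step_def power2_norm_eq_inner)
    have res0: "A (dir j) \<bullet> res (Suc k) = 0" if "j < Suc k" for j
      using that Suc dsc stp
      by (cases "j = k") (simp_all add: res_Suc inner_diff_right)
    \<comment> \<open>\<open>grad j\<close> is a combination of \<open>dir j\<close> and its
      predecessor, both orthogonal to \<open>grad (Suc k)\<close> by \<open>res0\<close>.\<close>
    have grad0: "grad j \<bullet> grad (Suc k) = 0" if "j < Suc k" for j
    proof (cases j)
      case 0
      then show ?thesis
        using res0[of 0] A_dir_inner[of 0 "Suc k"] by (simp add: dir_0)
    next
      case (Suc i)
      then have "dir j \<bullet> grad (Suc k) = 0" "dir i \<bullet> grad (Suc k) = 0"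
        using res0[of i] res0[of j] that by (simp_all add: A_dir_inner)
      then show ?thesis
        by (simp add: Suc dir_Suc inner_add_left)
    qed
    have "A (dir j) \<bullet> A (dir (Suc k)) = 0" if j: "j < Suc k" for j
    proof (cases "A (dir j) = 0 \<or> grad j = 0")
      case True \<comment> \<open>exactly the case \<open>step j = 0\<close>, where the division by \<open>step j\<close> below fails\<close>
      then show ?thesis
        using grad_eq_0_mono[of j "Suc k"] j by (auto simp: dir_eq_0 A_zero)
    next
      case False
      then have nz: "step j \<noteq> 0" by (simp add: step_def)
      have "A (dir j) \<bullet> A (dir (Suc k)) =
          A (grad (Suc k)) \<bullet> A (dir j) + corr k * (A (dir j) \<bullet> A (dir k))"
        by (simp add: dir_Suc A_add A_scale grad_in dir_in subspace subspace_scale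
            inner_add_right inner_commute)
      also have "A (grad (Suc k)) \<bullet> A (dir j) = grad (Suc k) \<bullet> A' (A (dir j))"
        by (simp add: adj grad_in)
      finally have "step j * (A (dir j) \<bullet> A (dir (Suc k))) =
          grad (Suc k) \<bullet> (step j *\<^sub>R A' (A (dir j)))
          + corr k * (step j * (A (dir j) \<bullet> A (dir k)))"
        by (simp add: algebra_simps)
      also have "step j *\<^sub>R A' (A (dir j)) = grad j - grad (Suc j)"
        by (simp add: grad_Suc)
      also have "grad (Suc k) \<bullet> (grad j - grad (Suc j))
          + corr k * (step j * (A (dir j) \<bullet> A (dir k))) = 0"
      \<comment> \<open>For \<open>j = k\<close> the terms are the negative and the positive of
        \<open>(norm (grad (Suc k)))^2\<close>; for \<open>j < k\<close> both vanish, by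
        \<open>grad0\<close> and the induction hypothesis.\<close>
      proof (cases "j = k")
        case True
        then show ?thesis
          using grad0[OF j] stp corr_mult[of k]
          by (simp add: inner_diff_right inner_commute power2_norm_eq_inner)
      next
        case False
        then show ?thesis
          using grad0[OF j] grad0[of "Suc j"] j Suc
          by (simp add: inner_diff_right inner_commute)
      qed
      finally show ?thesis using nz by simp
    qed
    then show ?case using res0 by simp
  qed
  show "\<forall>j<k. A (dir j) \<bullet> res k = 0 \<and> A (dir j) \<bullet> A (dir k) = 0"
    by (rule *)
  show "A (dir k) \<bullet> res k = (norm (grad k))\<^sup>2"
    using * by (intro descent') simp
qed

section \<open>Convergence of the residuals and decay of the gradients\<close>

lemma res_inner:
  assumes "j \<le> k" shows "res j \<bullet> res k = (norm (res k))\<^sup>2"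
  using assms
proof (induction rule: inc_induct)
  case base
  show ?case by (simp add: power2_norm_eq_inner)
next
  case (step n)
  \<comment> \<open>\<open>res n\<close> and \<open>res (Suc n)\<close> differ by a multiple of
    \<open>A (dir n)\<close>, which is orthogonal to \<open>res k\<close> since
    \<open>n < k\<close>.\<close>
  then show ?case
    using orthogonality[of k] by (simp add: res_Suc inner_diff_left)
qed

lemma res_dist:
  assumes "j \<le> k" shows "(dist (res j) (res k))\<^sup>2 = (norm (res j))\<^sup>2 - (norm (res k))\<^sup>2"
  using res_inner[OF assms]
  by (simp add: dist_norm power2_norm_eq_inner inner_diff_left inner_diff_right inner_commute)

lemma Cauchy_res: "Cauchy res"
  by (rule Cauchy_dist_le_telescope[where g = "\<lambda>k. (norm (res k))\<^sup>2"]) (simp_all add: res_dist)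

text \<open>The decrease equals \<open>step k * (norm (grad k))^2\<close>, and nonexpansiveness of
  \<open>A\<close> makes \<open>step k\<close> at least 1 unless the gradient vanishes.\<close>

lemma grad_le_decrease: "(norm (grad k))\<^sup>2 \<le> (norm (res k))\<^sup>2 - (norm (res (Suc k)))\<^sup>2"
proof -
  \<comment> \<open>\<open>A (dir k)\<close> is \<open>A (grad k)\<close> plus a multiple of the
    preceding image direction, to which it is orthogonal; hence it is no longer than
    \<open>A (grad k)\<close>.\<close>
  have A_grad: "A (dir k) \<bullet> A (grad k) = (norm (A (dir k)))\<^sup>2"
  proof (cases k)
    case 0
    then show ?thesis by (simp add: dir_0 power2_norm_eq_inner)
  next
    case (Suc i)
    have "A (dir k) = A (grad k) + corr i *\<^sub>R A (dir i)"
      by (simp add: Suc dir_Suc A_add A_scale grad_in dir_in subspace subspace_scale)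
    then have "A (dir k) \<bullet> A (dir k) = A (dir k) \<bullet> A (grad k) + corr i * (A (dir k) \<bullet> A (dir i))"
      by (metis inner_add_right inner_scaleR_right)
    then show ?thesis
      using orthogonality[of k] by (simp add: Suc power2_norm_eq_inner inner_commute)
  qed
  have "(norm (A (dir k)))\<^sup>2 \<le> norm (A (dir k)) * norm (A (grad k))"
    unfolding A_grad[symmetric] by (rule norm_cauchy_schwarz)
  then have "norm (A (dir k)) \<le> norm (A (grad k))"
    by (cases "A (dir k) = 0") (simp_all add: power2_eq_square)
  also have "\<dots> \<le> norm (grad k)"
    by (simp add: norm_A grad_in)
  finally have le: "(norm (A (dir k)))\<^sup>2 \<le> (norm (grad k))\<^sup>2"
    by (simp add: power_mono)
  have "res k \<bullet> res (Suc k) = (norm (res k))\<^sup>2 - step k * (A (dir k) \<bullet> res k)"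
    by (simp add: res_Suc inner_diff_right inner_commute[of "res k" "A (dir k)"]
        power2_norm_eq_inner)
  then have "(norm (res (Suc k)))\<^sup>2 = (norm (res k))\<^sup>2 - step k * (norm (grad k))\<^sup>2"
    using res_inner[of k "Suc k"] descent[of k] by simp
  moreover have "(norm (grad k))\<^sup>2 \<le> step k * (norm (grad k))\<^sup>2"
  proof (cases "grad k = 0")
    case False
    then have "A (dir k) \<noteq> 0"
      using descent[of k] by auto
    then have "1 \<le> step k"
      using le by (simp add: step_def)
    then show ?thesis
      using mult_right_mono[of 1 "step k" "(norm (grad k))\<^sup>2"] by simp
  qed simp
  ultimately show ?thesis by simp
qed

lemma grad_tendsto_0: "grad \<longlonglongrightarrow> 0"
proof -
  have "decseq (\<lambda>k. (norm (res k))\<^sup>2)"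
    unfolding decseq_def using res_dist by (smt (verit) zero_le_power2)
  then obtain L where L: "(\<lambda>k. (norm (res k))\<^sup>2) \<longlonglongrightarrow> L"
    using decseq_convergent[of "\<lambda>k. (norm (res k))\<^sup>2" 0] by auto
  have "(\<lambda>k. (norm (res k))\<^sup>2 - (norm (res (Suc k)))\<^sup>2) \<longlonglongrightarrow> L - L"
    by (rule tendsto_diff[OF L LIMSEQ_Suc[OF L]])
  then have diff: "(\<lambda>k. (norm (res k))\<^sup>2 - (norm (res (Suc k)))\<^sup>2) \<longlonglongrightarrow> 0"
    by simp
  have "(\<lambda>k. (norm (grad k))\<^sup>2) \<longlonglongrightarrow> 0"
    by (rule tendsto_sandwich[OF _ _ tendsto_const diff]) (simp_all add: grad_le_decrease)
  then have "(\<lambda>k. norm (grad k)) \<longlonglongrightarrow> 0"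
    using tendsto_real_sqrt[of "\<lambda>k. (norm (grad k))\<^sup>2" 0 sequentially] by simp
  then show ?thesis
    by (rule tendsto_norm_zero_cancel)
qed

text \<open>Vanishing gradients make \<open>r\<close> orthogonal to the image of \<open>S\<close>,
  so \<open>r\<close> has the same inner product with \<open>b - A u\<close> as with itself, and
  Cauchy-Schwarz applies.\<close>

lemma res_limit_le:
  assumes lim: "res \<longlonglongrightarrow> r" and u: "u \<in> S"
  shows "norm r \<le> norm (b - A u)"
proof -
  have orth: "A v \<bullet> r = 0" if "v \<in> S" for v
  proof -
    have "(\<lambda>k. A v \<bullet> res k) \<longlonglongrightarrow> A v \<bullet> r"
      by (intro tendsto_intros lim)
    moreover have "(\<lambda>k. A v \<bullet> res k) \<longlonglongrightarrow> v \<bullet> 0"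
      using that by (simp only: adj grad_def[symmetric]) (intro tendsto_intros grad_tendsto_0)
    ultimately have "A v \<bullet> r = v \<bullet> 0"
      by (rule LIMSEQ_unique)
    then show ?thesis by simp
  qed
  have "(\<lambda>k. res k \<bullet> r) \<longlonglongrightarrow> r \<bullet> r"
    by (intro tendsto_intros lim)
  moreover have "(\<lambda>k. res k \<bullet> r) = (\<lambda>k. (b - A u) \<bullet> r)"
    by (simp add: res_eq inner_diff_left orth iter_in u)
  ultimately have "r \<bullet> r = (b - A u) \<bullet> r"
    by (simp only: LIMSEQ_const_iff)
  then have "norm r * norm r \<le> norm (b - A u) * norm r"
    using norm_cauchy_schwarz[of "b - A u" r] power2_norm_eq_inner[of r]
    by (simp only: power2_eq_square)
  then show ?thesis
    by (cases "r = 0") simp_all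
qed

section \<open>Monotone errors and convergence at a solvable level\<close>

lemma step_nonneg: "0 \<le> step k" and corr_nonneg: "0 \<le> corr k"
  by (simp_all add: step_def corr_def)

text \<open>Unrolled, \<open>aux i\<close> is a nonnegative combination of the residuals up to
  \<open>i\<close>, and each of these has inner product \<open>(norm (res k))^2\<close> with
  \<open>res k\<close>.\<close>

lemma aux_res_nonneg: "i \<le> k \<Longrightarrow> 0 \<le> aux i \<bullet> res k"
proof (induction i)
  case 0
  then show ?case by (simp add: aux_0 res_inner)
next
  case (Suc i)
  then show ?case
    by (simp add: aux_Suc inner_add_left res_inner corr_nonneg)
qed

text \<open>Expanding the squares leaves twice the inner product of \<open>iter k - iter j\<close>
  with \<open>u - iter k\<close>. The displacement is a nonnegative combination of directions, and
  the adjoint turns \<open>dir n\<close> against the error into \<open>aux n\<close> against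
  \<open>res k\<close>.\<close>

lemma error_dist:
  assumes u: "u \<in> S" "A u = b" and "j \<le> k"
  shows "(dist (iter j) (iter k))\<^sup>2 \<le> (norm (u - iter j))\<^sup>2 - (norm (u - iter k))\<^sup>2"
proof -
  have "0 \<le> (iter k - iter j) \<bullet> (u - iter k)"
    using \<open>j \<le> k\<close>
  proof (induction rule: inc_induct)
    case base
    show ?case by simp
  next
    case (step n)
    have "dir n \<bullet> (u - iter k) = A (u - iter k) \<bullet> aux n"
      using adj[of "u - iter k" "aux n"] u
      by (simp add: iter_in subspace subspace_diff dir_def inner_commute)
    also have "A (u - iter k) = res k"
      by (simp add: A_diff u iter_in res_eq)
    finally have "0 \<le> dir n \<bullet> (u - iter k)"
      using aux_res_nonneg[of n k] step by (simp add: inner_commute)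
    then have "0 \<le> step n * (dir n \<bullet> (u - iter k))"
      by (simp add: step_nonneg)
    then show ?case
      using step by (simp add: iter_Suc inner_diff_left inner_add_left)
  qed
  moreover have "(norm (u - iter j))\<^sup>2 - (norm (u - iter k))\<^sup>2 - (dist (iter j) (iter k))\<^sup>2
      = 2 * ((iter k - iter j) \<bullet> (u - iter k))"
    by (simp add: dist_norm power2_norm_eq_inner inner_diff_left inner_diff_right inner_commute)
  ultimately show ?thesis by simp
qed

end

lemma cgne_converges:
  fixes S :: "'x::{real_inner, complete_space} set" and A :: "'x \<Rightarrow> 'y::real_inner"
  assumes "cgne_problem S A A' x0" and "closed S" and u: "u \<in> S" "A u = b"
  shows "\<exists>x\<in>S. A x = b \<and> cgne_iterate A A' b x0 \<longlonglongrightarrow> x"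
proof -
  interpret cgne_problem S A A' b x0 by fact
  have "Cauchy iter"
    by (rule Cauchy_dist_le_telescope[OF error_dist[OF u]]) simp_all
  then obtain x where x: "iter \<longlonglongrightarrow> x"
    using Cauchy_convergent convergent_def by blast
  have "x \<in> S"
    using \<open>closed S\<close> iter_in x closed_sequentially by blast
  \<comment> \<open>\<open>A\<close> is controlled on \<open>S\<close> only, which is why the limit
    had to be placed in \<open>S\<close> first.\<close>
  have "(\<lambda>k. A (iter k) - A x) \<longlonglongrightarrow> 0"
  proof (rule Lim_null_comparison)
    show "\<forall>\<^sub>F k in sequentially. norm (A (iter k) - A x) \<le> norm (iter k - x)"
      using norm_A \<open>x \<in> S\<close>
      by (simp add: A_diff[symmetric] iter_in subspace subspace_diff)
    show "(\<lambda>k. norm (iter k - x)) \<longlonglongrightarrow> 0"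
      using x by (simp add: tendsto_norm_zero LIM_zero)
  qed
  then have "(\<lambda>k. b - A (iter k)) \<longlonglongrightarrow> b - A x"
    by (intro tendsto_intros) (rule LIM_zero_cancel)
  then have "res \<longlonglongrightarrow> b - A x"
    by (simp add: res_eq[abs_def])
  \<comment> \<open>The exact solution \<open>u\<close> as competitor forces the limiting residual
    to zero.\<close>
  from res_limit_le[OF this u(1)] have "norm (b - A x) \<le> 0"
    using u(2) by simp
  then have "A x = b" by simp
  moreover have "cgne_iterate A A' b x0 \<longlonglongrightarrow> x"
    using x by (simp add: iter_def[abs_def])
  ultimately show ?thesis
    using \<open>x \<in> S\<close> by blast
qed

text \<open>The limit of the squared residual norms lies strictly below \<open>c\<close>, so all
  late iterates pass; a positive index is sought because the discrepancy test skips index 0.\<close>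

lemma cgne_residual_le:
  fixes S :: "'x::real_inner set" and A :: "'x \<Rightarrow> 'y::{real_inner, complete_space}"
  assumes "cgne_problem S A A' x0" and u: "u \<in> S" and "norm (b - A u) * norm b < c"
  shows "\<exists>k>0. (norm (A (cgne_iterate A A' b x0 k) - b))\<^sup>2 \<le> c"
proof -
  interpret cgne_problem S A A' b x0 by fact
  obtain r where r: "res \<longlonglongrightarrow> r"
    using Cauchy_res Cauchy_convergent convergent_def by blast
  have "norm r \<le> norm (b - A u)" "norm r \<le> norm b"
    using res_limit_le[OF r u] res_limit_le[OF r, of 0] by (simp_all add: A_zero subspace subspace_0)
  then have "(norm r)\<^sup>2 \<le> norm (b - A u) * norm b"
    by (simp add: power2_eq_square mult_mono)
  then have "(norm r)\<^sup>2 < c"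
    using assms(3) by simp
  moreover have "(\<lambda>k. (norm (res k))\<^sup>2) \<longlonglongrightarrow> (norm r)\<^sup>2"
    by (intro tendsto_intros r)
  ultimately have "\<forall>\<^sub>F k in sequentially. (norm (res k))\<^sup>2 < c"
    by (simp add: order_tendsto_iff)
  then have "\<forall>\<^sub>F k in sequentially. 0 < k \<and> (norm (res k))\<^sup>2 < c"
    using eventually_gt_at_top[of "0::nat"] by eventually_elim simp
  then obtain k where "0 < k" "(norm (res k))\<^sup>2 < c"
    by (auto simp: eventually_sequentially)
  then show ?thesis
    by (metis res_eq iter_def less_imp_le norm_minus_commute)
qed

section \<open>The multi-level iteration\<close>

lemma orthogonal_projector_fix:
  assumes "orthogonal_projector S Q" and "subspace S" and "u \<in> S"
  shows "Q u = u"
proof -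
  have "u - Q u \<in> S"
    using assms by (auto simp: orthogonal_projector_def subspace_diff)
  then have "(u - Q u) \<bullet> (u - Q u) = 0"
    using assms(1) by (auto simp: orthogonal_projector_def orthogonal_def)
  then show ?thesis by simp
qed

text \<open>\<open>l - Q l\<close> is orthogonal to every \<open>f n - Q l\<close>, hence in the
  limit to itself. This supplies the closedness that \<open>cgne_converges\<close> asks for.\<close>

lemma orthogonal_projector_closed:
  assumes Q: "orthogonal_projector S Q" and S: "subspace S"
  shows "closed S"
  unfolding closed_sequential_limits
proof (intro allI impI)
  fix f :: "nat \<Rightarrow> 'a" and l assume f: "(\<forall>n. f n \<in> S) \<and> f \<longlonglongrightarrow> l"
  have "(\<lambda>n. (l - Q l) \<bullet> (f n - Q l)) = (\<lambda>n. 0)"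
    using Q S f by (auto simp: orthogonal_projector_def orthogonal_def subspace_diff)
  moreover have "(\<lambda>n. (l - Q l) \<bullet> (f n - Q l)) \<longlonglongrightarrow> (l - Q l) \<bullet> (l - Q l)"
    using f by (intro tendsto_intros) simp
  ultimately have "(l - Q l) \<bullet> (l - Q l) = 0"
    by (simp only: LIMSEQ_const_iff)
  then have "l = Q l" by simp
  then show "l \<in> S"
    using Q by (metis orthogonal_projector_def)
qed

section \<open>Runs of the multi-level algorithm\<close>

lemma ml_run_0: "ml_run T T' P xs \<eta> \<tau> \<delta> b s 0 = s"
  and ml_run_Suc: "ml_run T T' P xs \<eta> \<tau> \<delta> b s (Suc n) =
    ml_step T T' P xs \<eta> \<tau> \<delta> b (ml_run T T' P xs \<eta> \<tau> \<delta> b s n)"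
  by (simp_all add: ml_run_def)

lemma ml_run_add: "ml_run T T' P xs \<eta> \<tau> \<delta> b s (m + n) =
    ml_run T T' P xs \<eta> \<tau> \<delta> b (ml_run T T' P xs \<eta> \<tau> \<delta> b s n) m"
  by (simp add: ml_run_def funpow_add)

lemma ml_run_Finished: "ml_run T T' P xs \<eta> \<tau> \<delta> b (Finished x) n = Finished x"
  by (induction n) (simp_all add: ml_run_0 ml_run_Suc)

text \<open>Stated for an arbitrary starting state, so that convergence can be pulled back along a
  run and proved by induction over levels.\<close>

definition ml_converges ::
  "(nat \<Rightarrow> 'x set) \<Rightarrow> (nat \<Rightarrow> 'x::real_inner \<Rightarrow> 'y::real_inner) \<Rightarrow> (nat \<Rightarrow> 'y \<Rightarrow> 'x) \<Rightarrow>
   (nat \<Rightarrow> 'x \<Rightarrow> 'x) \<Rightarrow> 'x \<Rightarrow> real \<Rightarrow> real \<Rightarrow> real \<Rightarrow> 'y \<Rightarrow> 'x ml_state \<Rightarrow> bool" where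
  "ml_converges X T T' P xs \<eta> \<tau> \<delta> b s \<longleftrightarrow>
     (\<exists>xhat. is_solution X T b xhat \<and>
        ((\<exists>n. ml_run T T' P xs \<eta> \<tau> \<delta> b s n = Finished xhat) \<or>
         ((\<forall>n x. ml_run T T' P xs \<eta> \<tau> \<delta> b s n \<noteq> Finished x) \<and>
          (\<lambda>n. ml_iterate T T' b (ml_run T T' P xs \<eta> \<tau> \<delta> b s n)) \<longlonglongrightarrow> xhat)))"

lemma ml_converges_Finished:
  "is_solution X T b x \<Longrightarrow> ml_converges X T T' P xs \<eta> \<tau> \<delta> b (Finished x)"
  unfolding ml_converges_def using ml_run_0 by blast

text \<open>A finite initial segment does not affect the limit, and \<open>Finished\<close> is
  absorbing, so a termination before step \<open>m\<close> would still be visible at step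
  \<open>m\<close>.\<close>

lemma ml_converges_run:
  assumes "ml_converges X T T' P xs \<eta> \<tau> \<delta> b (ml_run T T' P xs \<eta> \<tau> \<delta> b s m)"
  shows "ml_converges X T T' P xs \<eta> \<tau> \<delta> b s"
proof -
  let ?run = "ml_run T T' P xs \<eta> \<tau> \<delta> b"
  obtain xhat where sol: "is_solution X T b xhat"
    and alt: "(\<exists>n. ?run s (n + m) = Finished xhat) \<or>
       ((\<forall>n x. ?run s (n + m) \<noteq> Finished x) \<and>
        (\<lambda>n. ml_iterate T T' b (?run s (n + m))) \<longlonglongrightarrow> xhat)"
    using assms by (auto simp: ml_converges_def ml_run_add)
  from alt show ?thesis
  proof
    assume "\<exists>n. ?run s (n + m) = Finished xhat"
    then show ?thesis
      using sol by (auto simp: ml_converges_def)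
  next
    assume inf: "(\<forall>n x. ?run s (n + m) \<noteq> Finished x) \<and>
        (\<lambda>n. ml_iterate T T' b (?run s (n + m))) \<longlonglongrightarrow> xhat"
    have "?run s n \<noteq> Finished x" for n x
      using inf ml_run_add[of T T' P xs \<eta> \<tau> \<delta> b s m n]
      by (metis add.commute ml_run_Finished)
    moreover have "(\<lambda>n. ml_iterate T T' b (?run s n)) \<longlonglongrightarrow> xhat"
      using inf by (auto intro: LIMSEQ_offset[where k = m])
    ultimately show ?thesis
      using sol by (auto simp: ml_converges_def)
  qed
qed

text \<open>Iterate \<open>k\<close> is tested only on leaving its state, and index 0 never is;
  hence only the indices strictly between matter.\<close>

lemma ml_run_level:
  assumes "\<And>j. 0 < j \<Longrightarrow> j < k \<Longrightarrow>
    level_bound P xs \<eta> \<delta> b N < (norm (T N (cgne_iterate (T N) (T' N) b z j) - b))\<^sup>2"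
  shows "ml_run T T' P xs \<eta> \<tau> \<delta> b (Iterating N z 0) k = Iterating N z k"
  using assms
proof (induction k)
  case 0
  show ?case by (simp add: ml_run_0)
next
  case (Suc k)
  then have "ml_run T T' P xs \<eta> \<tau> \<delta> b (Iterating N z 0) k = Iterating N z k"
    by simp
  then show ?case
    using Suc.prems[of k] by (auto simp: ml_run_Suc Let_def not_le)
qed

theorem theorem2p6:
  fixes X :: "nat \<Rightarrow> 'x::{real_inner, complete_space} set"
    and P :: "nat \<Rightarrow> 'x \<Rightarrow> 'x"
    and T :: "nat \<Rightarrow> 'x \<Rightarrow> 'y::{real_inner, complete_space}"
    and T' :: "nat \<Rightarrow> 'y \<Rightarrow> 'x"
    and y :: 'y and xs x00 :: 'x and Ns :: nat and \<eta> \<tau> :: real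
  assumes "separable_space (euclidean :: 'x topology)"
    and "separable_space (euclidean :: 'y topology)"
    and "\<And>N. subspace (X N)"
    and "\<And>N. X N \<subseteq> X (Suc N)"
    and "\<And>N. orthogonal_projector (X N) (P N)"
    and "\<And>N. linear_on_subspace (X N) (T N)"
    and "\<And>N x. x \<in> X N \<Longrightarrow> norm (T N x) \<le> norm x"
    and "\<And>M N x. M \<le> N \<Longrightarrow> x \<in> X M \<Longrightarrow> T N x = T M x"
    and "\<And>N. adjoint_on (X N) (T N) (T' N)"
    and "\<And>N. range (T' N) \<subseteq> X N"
    and "xs \<in> X Ns" and "T Ns xs = y"
    and "\<eta> > 0" and "\<tau> > 1"
    and "x00 \<in> X 0"
  shows "(\<exists>s. ml_initial T P xs \<eta> \<tau> 0 y x00 s) \<and>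
    (\<forall>s. ml_initial T P xs \<eta> \<tau> 0 y x00 s \<longrightarrow>
      (\<exists>xhat. is_solution X T y xhat \<and>
        ((\<exists>n. ml_run T T' P xs \<eta> \<tau> 0 y s n = Finished xhat) \<or>
         ((\<forall>n x. ml_run T T' P xs \<eta> \<tau> 0 y s n \<noteq> Finished x) \<and>
          (\<lambda>n. ml_iterate T T' y (ml_run T T' P xs \<eta> \<tau> 0 y s n)) \<longlonglongrightarrow> xhat))))"
proof -
  note sub = assms(3) and proj = assms(5) and lin = assms(6) and nrm = assms(7)
    and cons = assms(8) and adj = assms(9) and rng = assms(10) and xs = assms(11,12)
    and eta = assms(13)
  have nested: "X M \<subseteq> X N" if "M \<le> N" for M N
    using that assms(4) by (metis lift_Suc_mono_le)
  have prob: "cgne_problem (X N) (T N) (T' N) z" if "z \<in> X N" for N z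
    using that sub lin nrm adj rng by unfold_locales auto
  have T_xs: "T M xs = y" if "xs \<in> X M" for M
    using xs that cons[of M Ns xs] cons[of Ns M xs] by (cases "M \<le> Ns") auto
  have bound: "level_bound P xs \<eta> 0 y N = 2 * (1 + \<eta>) * (norm (P N xs - xs) * norm y)" for N
    by (simp add: level_bound_def)
  have bound_Ns: "level_bound P xs \<eta> 0 y N = 0" if "Ns \<le> N" for N
    using orthogonal_projector_fix[OF proj sub, of xs N] nested[OF that] xs(1)
    by (auto simp: bound)
  have bound_nonneg: "0 \<le> level_bound P xs \<eta> 0 y N" for N
    using eta by (simp add: bound)
  have P_in: "P N v \<in> X N" for N v
    using proj by (auto simp: orthogonal_projector_def)

  \<comment> \<open>A zero bound means that \<open>P N xs = xs\<close>, which puts \<open>xs\<close>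
    into \<open>X N\<close>, or that \<open>y = 0\<close>, which \<open>0\<close> solves.\<close>
  have solvable: "\<exists>u\<in>X N. T N u = y" if "level_bound P xs \<eta> 0 y N = 0" for N
  proof -
    have "P N xs = xs \<or> y = 0"
      using that eta by (auto simp: bound)
    moreover have "T N 0 = 0"
      using lin[of N] subspace_0[OF sub, of N] unfolding linear_on_subspace_def
      by (metis scaleR_zero_left)
    ultimately show ?thesis
      using T_xs[of N] P_in[of N xs] subspace_0[OF sub, of N] by metis
  qed

  have exit_level: "\<exists>k>0. (norm (T N (cgne_iterate (T N) (T' N) y z k) - y))\<^sup>2
      \<le> level_bound P xs \<eta> 0 y N"
    if z: "z \<in> X N" and pos: "0 < level_bound P xs \<eta> 0 y N" for N z
  proof (rule cgne_residual_le[OF prob[OF z] P_in[of N xs]])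
    \<comment> \<open>A level containing both \<open>xs\<close> and \<open>P N xs\<close>, where
      nonexpansiveness applies to their difference.\<close>
    define M where "M = max N Ns"
    have xsM: "xs \<in> X M" and PM: "P N xs \<in> X M"
      using nested[of Ns M] nested[of N M] xs(1) P_in[of N xs] by (auto simp: M_def)
    have "P N xs + (xs - P N xs) = xs" "xs - P N xs \<in> X M"
      using xsM PM sub by (simp_all add: subspace_diff)
    then have "T M xs = T M (P N xs) + T M (xs - P N xs)"
      using lin[of M] PM unfolding linear_on_subspace_def by metis
    then have "y - T N (P N xs) = T M (xs - P N xs)"
      using cons[of N M "P N xs"] P_in[of N xs] T_xs[OF xsM] by (auto simp: M_def algebra_simps)
    then have "norm (y - T N (P N xs)) \<le> norm (P N xs - xs)"
      using nrm[OF \<open>xs - P N xs \<in> X M\<close>] by (simp add: norm_minus_commute)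
    then have "norm (y - T N (P N xs)) * norm y \<le> norm (P N xs - xs) * norm y"
      by (simp add: mult_right_mono)
    also have "\<dots> < level_bound P xs \<eta> 0 y N"
      unfolding bound
    proof -
      have "0 < norm (P N xs - xs) * norm y"
        using pos eta unfolding bound by (auto simp: zero_less_mult_iff)
      then show "norm (P N xs - xs) * norm y < 2 * (1 + \<eta>) * (norm (P N xs - xs) * norm y)"
        using eta mult_strict_right_mono[of 1 "2 * (1 + \<eta>)"] by fastforce
    qed
    finally show "norm (y - T N (P N xs)) * norm y < level_bound P xs \<eta> 0 y N" .
  qed

  have conv: "ml_converges X T T' P xs \<eta> \<tau> 0 y (Iterating N z 0)" if "z \<in> X N" for N z
    using that
  \<comment> \<open>Truncated subtraction suffices: the next level is entered only from
    \<open>N < Ns\<close>, where the measure drops.\<close>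
  proof (induction "Ns - N" arbitrary: N z rule: less_induct)
    case less
    let ?x = "cgne_iterate (T N) (T' N) y z"
    let ?pass = "\<lambda>k. 0 < k \<and> (norm (T N (?x k) - y))\<^sup>2 \<le> level_bound P xs \<eta> 0 y N"
    interpret cgne_problem "X N" "T N" "T' N" y z
      by (rule prob[OF less.prems])
    have x_in: "?x k \<in> X N" for k
      using iter_in by (simp add: iter_def)
    show ?case
    proof (cases "\<exists>k. ?pass k")
      \<comment> \<open>No iterate passes, so the bound cannot be positive; the run stays at this
        solvable level forever.\<close>
      case False
      then have "\<not> 0 < level_bound P xs \<eta> 0 y N"
        using exit_level[OF less.prems] by blast
      then have "level_bound P xs \<eta> 0 y N = 0"
        using bound_nonneg[of N] by linarith
      then obtain u where "u \<in> X N" "T N u = y"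
        using solvable by blast
      then obtain x where x: "x \<in> X N" "T N x = y" "?x \<longlonglongrightarrow> x"
        using cgne_converges[OF prob[OF less.prems] orthogonal_projector_closed[OF proj sub]]
        by blast
      have "ml_run T T' P xs \<eta> \<tau> 0 y (Iterating N z 0) k = Iterating N z k" for k
        using False by (intro ml_run_level) (meson not_le)
      then show ?thesis
        using x by (auto simp: ml_converges_def is_solution_def)
    next
      case True
      define k where "k = (LEAST k. ?pass k)"
      have k: "?pass k"
        unfolding k_def by (rule LeastI_ex[OF True])
      have "\<not> ?pass j" if "j < k" for j
        using that not_less_Least unfolding k_def by blast
      then have run: "ml_run T T' P xs \<eta> \<tau> 0 y (Iterating N z 0) k = Iterating N z k"
        by (intro ml_run_level) (meson not_le)
      let ?s = "ml_run T T' P xs \<eta> \<tau> 0 y (Iterating N z 0) (Suc k)"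
      have "ml_converges X T T' P xs \<eta> \<tau> 0 y ?s"
      \<comment> \<open>For exact data \<open>final_bound\<close> is 0, so the termination test is
        exactly this equality.\<close>
      proof (cases "T (Suc N) (?x k) = y")
        case True
        then have "?s = Finished (?x k)"
          using k by (simp add: ml_run_Suc run final_bound_def)
        moreover have "is_solution X T y (?x k)"
          using True x_in[of k] nested[of N "Suc N"] by (auto simp: is_solution_def)
        ultimately show ?thesis
          by (simp add: ml_converges_Finished)
      next
        case False
        then have s: "?s = Iterating (Suc N) (?x (k - 1)) 0"
          using k by (simp add: ml_run_Suc run final_bound_def)
        \<comment> \<open>With a zero bound, passing the discrepancy test would mean solving the
          equation; so the bound is nonzero and \<open>N < Ns\<close>.\<close>
        have "T N (?x k) \<noteq> y"
          using False cons[of N "Suc N" "?x k"] x_in[of k] by simp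
        then have "level_bound P xs \<eta> 0 y N \<noteq> 0"
          using k by auto
        then have "N < Ns"
          using bound_Ns[of N] by force
        then show ?thesis
          unfolding s using x_in[of "k - 1"] nested[of N "Suc N"] by (intro less.hyps) auto
      qed
      then show ?thesis
        by (rule ml_converges_run)
    qed
  qed

  have "\<exists>s. ml_initial T P xs \<eta> \<tau> 0 y x00 s"
  proof -
    \<comment> \<open>\<open>Ns\<close> is an admissible choice of \<open>J\<close>: its bound is 0,
      while the residual of \<open>x00\<close> is the same as at level 0.\<close>
    have "T Ns x00 = T 0 x00"
      using cons[of 0 Ns x00] assms(15) by simp
    then have "level_bound P xs \<eta> 0 y Ns < (norm (T Ns x00 - y))\<^sup>2"
      if "final_bound \<eta> \<tau> 0 y < (norm (T 0 x00 - y))\<^sup>2"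
      using that bound_Ns[of Ns] by (simp add: final_bound_def)
    then show ?thesis
      by (auto simp: ml_initial_def)
  qed
  moreover have "ml_converges X T T' P xs \<eta> \<tau> 0 y s"
    if init: "ml_initial T P xs \<eta> \<tau> 0 y x00 s" for s
  proof -
    have "(s = Finished x00 \<and> T 0 x00 = y) \<or> (\<exists>J. s = Iterating J x00 0)"
      using init by (auto simp: ml_initial_def final_bound_def split: if_splits)
    then show ?thesis
    proof
      assume "s = Finished x00 \<and> T 0 x00 = y"
      then show ?thesis
        using assms(15) by (auto simp: is_solution_def intro!: ml_converges_Finished)
    next
      assume "\<exists>J. s = Iterating J x00 0"
      then show ?thesis
        using conv nested[of 0] assms(15) by auto
    qed
  qed
  ultimately show ?thesis
    unfolding ml_converges_def by blast
qed

end
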